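(* Let $n\ge 2$ and let $\Gamma=\mathcal{P}_e(SD_{8n})$ be the enhanced power graph of the semidihedral group $SD_{8n}$. The detour distance degree sequences of the vertices of $\Gamma$ are, with the indicated multiplicities (the exponent outside the parentheses is the number of vertices having that sequence; no exponent means exactly one vertex), \[dds_D(\Gamma)=\Big\{(1,2n,0^{4n-3},1,0,6n-2),\ (1,0^{4n-2},1,2n,6n-2),\ (1,0^{4n},4n-1,(2n)^2)^{4n-2},\ (1^2,2n-1,0^{4n-3},1,0,6n-2)^{2n},\ (1,0^{4n},3,2n,6n-4)^{2n}\Big\}.\]
   Context: For $n\ge 2$, the semidihedral group of order $8n$ is $SD_{8n}=\langle a,b : a^{4n}=b^2=e,\ ba=a^{2n-1}b\rangle$. The enhanced power graph $\mathcal{P}_e(G)$ of a finite group $G$ is the simple undirected graph with vertex set $G$ in which two distinct vertices $x,y$ are adjacent if and only if $x,y\in\langle z\rangle$ for some $z\in G$. In a connected graph, the detour distance $d_D(u,v)$ is the length (number of edges) of a longest $u$–$v$ path (no repeated vertices); in particular $d_D(u,u)=0$. The detour eccentricity $ecc_D(u)$ is the maximum of $d_D(u,v)$ over all vertices $v$. For a vertex $x$, let $D_i(x)$ be the number of vertices at detour distance $i$ from $x$. The detour distance degree sequence of $x$ is $dds_D(x)=(D_0(x),D_1(x),\ldots,D_{ecc_D(x)}(x))$, and $dds_D(\Gamma)$ denotes the multiset of the sequences $dds_D(x)$ over all vertices $x$ of $\Gamma$. Inside a sequence, $c^t$ means that the entry $c$ occurs $t$ consecutive times. *)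

theory Defs
  imports
    "HOL-Algebra.Generated_Groups"
    "HOL-Library.Multiset"
    "Graph_Theory.Pair_Digraph"
begin

section \<open>Groups given by generators and relations\<close>

text \<open>
  The type \<open>'g\<close> is the set of generators. The letter \<open>(x, True)\<close> stands for \<open>x\<close> and
  \<open>(x, False)\<close> for its inverse. A relation \<open>l = r\<close> is the pair of words \<open>(l, r)\<close>.
\<close>

type_synonym 'g gword = "('g \<times> bool) list"

inductive word_cong :: "('g gword \<times> 'g gword) set \<Rightarrow> 'g gword \<Rightarrow> 'g gword \<Rightarrow> bool"
  for R where
  refl: "word_cong R u u"
| sym: "word_cong R u v \<Longrightarrow> word_cong R v u"
| trans: "word_cong R u v \<Longrightarrow> word_cong R v w \<Longrightarrow> word_cong R u w"
| cancel: "word_cong R (u @ [(x, s), (x, \<not> s)] @ v) (u @ v)"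
| rel: "(l, r) \<in> R \<Longrightarrow> word_cong R (u @ l @ v) (u @ r @ v)"

definition word_class :: "('g gword \<times> 'g gword) set \<Rightarrow> 'g gword \<Rightarrow> 'g gword set" where
  "word_class R u = {v. word_cong R u v}"

definition presented_group :: "('g gword \<times> 'g gword) set \<Rightarrow> 'g gword set monoid" where
  "presented_group R =
    \<lparr>carrier = range (word_class R),
     monoid.mult = (\<lambda>X Y. \<Union>u\<in>X. \<Union>v\<in>Y. word_class R (u @ v)),
     monoid.one = word_class R []\<rparr>"

lemma word_cong_context: "word_cong R u v \<Longrightarrow> word_cong R (p @ u @ q) (p @ v @ q)"
proof (induction rule: word_cong.induct)
  case (cancel u x s v)
  show ?case using word_cong.cancel[of R "p @ u" x s "v @ q"] by simp
next
  case (rel l r u v)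
  then show ?case using word_cong.rel[of l r R "p @ u" "v @ q"] by simp
next
  case (refl u)
  show ?case by (rule word_cong.refl)
next
  case (sym u v)
  show ?case by (rule word_cong.sym) (rule sym.IH)
next
  case (trans u v w)
  show ?case by (rule word_cong.trans) (rule trans.IH)+
qed

lemma word_cong_append:
  assumes "word_cong R u u'" "word_cong R v v'"
  shows "word_cong R (u @ v) (u' @ v')"
  using word_cong.trans[of R "u @ v" "u' @ v" "u' @ v'"]
    word_cong_context[OF assms(1), of "[]" v] word_cong_context[OF assms(2), of u' "[]"]
  by simp

lemma word_class_eq_iff: "word_class R u = word_class R v \<longleftrightarrow> word_cong R u v"
proof
  assume "word_class R u = word_class R v"
  moreover have "v \<in> word_class R v" by (simp add: word_class_def word_cong.refl)
  ultimately have "v \<in> word_class R u" by simp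
  then show "word_cong R u v" by (simp add: word_class_def)
next
  assume "word_cong R u v"
  then show "word_class R u = word_class R v"
    unfolding word_class_def
    by (intro Collect_cong iffI) (erule word_cong.trans[OF word_cong.sym] word_cong.trans, assumption)+
qed

lemma presented_group_mult:
  "word_class R u \<otimes>\<^bsub>presented_group R\<^esub> word_class R v = word_class R (u @ v)"
proof -
  have "word_class R (u' @ v') = word_class R (u @ v)"
    if "u' \<in> word_class R u" "v' \<in> word_class R v" for u' v'
  proof -
    have "word_cong R (u @ v) (u' @ v')"
      using that by (intro word_cong_append) (simp_all add: word_class_def)
    then show ?thesis unfolding word_class_eq_iff by (rule word_cong.sym)
  qed
  then have "(\<Union>u'\<in>word_class R u. \<Union>v'\<in>word_class R v. word_class R (u' @ v')) =
      (\<Union>u'\<in>word_class R u. \<Union>v'\<in>word_class R v. word_class R (u @ v))"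
    by (intro SUP_cong HOL.refl)
  also have "\<dots> = word_class R (u @ v)"
  proof -
    have "word_class R w \<noteq> {}" for w
      using word_cong.refl by (auto simp: word_class_def)
    then show ?thesis by simp
  qed
  finally show ?thesis by (simp add: presented_group_def)
qed

lemma word_cong_left_inv: "word_cong R (rev (map (\<lambda>(x, s). (x, \<not> s)) u) @ u) []"
proof (induction u)
  case (Cons c u)
  obtain x s where c: "c = (x, s)" by (cases c)
  have "word_cong R (rev (map (\<lambda>(x, s). (x, \<not> s)) u) @ [(x, \<not> s), (x, \<not> \<not> s)] @ u)
          (rev (map (\<lambda>(x, s). (x, \<not> s)) u) @ u)"
    by (rule word_cong.cancel)
  from word_cong.trans[OF this Cons.IH] show ?case by (simp add: c)
qed (simp add: word_cong.refl)

lemma group_presented_group: "group (presented_group R)"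
proof (rule groupI)
  show "\<one>\<^bsub>presented_group R\<^esub> \<in> carrier (presented_group R)"
    by (simp add: presented_group_def)
next
  fix X Y Z
  assume *: "X \<in> carrier (presented_group R)" "Y \<in> carrier (presented_group R)"
  then obtain u v where uv: "X = word_class R u" "Y = word_class R v"
    by (auto simp: presented_group_def)
  show "X \<otimes>\<^bsub>presented_group R\<^esub> Y \<in> carrier (presented_group R)"
    by (simp only: uv presented_group_mult) (simp add: presented_group_def)
  assume "Z \<in> carrier (presented_group R)"
  then obtain w where "Z = word_class R w" by (auto simp: presented_group_def)
  then show "X \<otimes>\<^bsub>presented_group R\<^esub> Y \<otimes>\<^bsub>presented_group R\<^esub> Z =
      X \<otimes>\<^bsub>presented_group R\<^esub> (Y \<otimes>\<^bsub>presented_group R\<^esub> Z)"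
    by (simp add: uv presented_group_mult)
next
  fix X assume "X \<in> carrier (presented_group R)"
  then obtain u where u: "X = word_class R u" by (auto simp: presented_group_def)
  have one: "\<one>\<^bsub>presented_group R\<^esub> = word_class R []" by (simp add: presented_group_def)
  show "\<one>\<^bsub>presented_group R\<^esub> \<otimes>\<^bsub>presented_group R\<^esub> X = X"
    by (simp add: one u presented_group_mult)
  let ?v = "rev (map (\<lambda>(x, s). (x, \<not> s)) u)"
  have "word_class R ?v \<otimes>\<^bsub>presented_group R\<^esub> X = \<one>\<^bsub>presented_group R\<^esub>"
    by (simp add: one u presented_group_mult word_class_eq_iff word_cong_left_inv)
  moreover have "word_class R ?v \<in> carrier (presented_group R)"
    by (simp add: presented_group_def)
  ultimately show "\<exists>Y\<in>carrier (presented_group R).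
      Y \<otimes>\<^bsub>presented_group R\<^esub> X = \<one>\<^bsub>presented_group R\<^esub>" by blast
qed

section \<open>The semidihedral group of order \<open>8n\<close>\<close>

datatype sd_gen = Gen_a | Gen_b

definition sd_relations :: "nat \<Rightarrow> (sd_gen gword \<times> sd_gen gword) set" where
  "sd_relations n =
    (let a = (Gen_a, True); b = (Gen_b, True) in
      {(replicate (4 * n) a, []),
       ([b, b], []),
       ([b, a], replicate (2 * n - 1) a @ [b])})"

definition semidihedral :: "nat \<Rightarrow> sd_gen gword set monoid" where
  "semidihedral n = presented_group (sd_relations n)"

section \<open>Enhanced power graphs\<close>

text \<open>Undirected simple graphs are symmetric loop-free digraphs, as in locale \<open>pair_graph\<close>.\<close>

definition enhanced_power_graph :: "('a, 'b) monoid_scheme \<Rightarrow> 'a pair_pre_digraph" where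
  "enhanced_power_graph G =
    \<lparr>pverts = carrier G,
     parcs = {(x, y). x \<in> carrier G \<and> y \<in> carrier G \<and> x \<noteq> y \<and>
                (\<exists>z\<in>carrier G. x \<in> generate G {z} \<and> y \<in> generate G {z})}\<rparr>"

lemma pair_graph_enhanced_power_graph:
  assumes "finite (carrier G)"
  shows "pair_graph (enhanced_power_graph G)"
proof unfold_locales
  have "parcs (enhanced_power_graph G) \<subseteq> carrier G \<times> carrier G"
    by (auto simp: enhanced_power_graph_def)
  then show "finite (parcs (enhanced_power_graph G))"
    using assms by (meson finite_SigmaI finite_subset)
  show "symmetric (with_proj (enhanced_power_graph G))"
    by (simp add: symmetric_def enhanced_power_graph_def sym_def) metis
qed (simp_all add: enhanced_power_graph_def assms split_beta)

section \<open>Detour distance\<close>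

text \<open>
  The list \<open>p\<close> in \<open>apath u p v\<close> consists of the arcs of the path, so its length is the number
  of edges. The following notions are meaningful for finite connected graphs only, where the
  sets below are finite and nonempty.
\<close>

definition detour_dist :: "'a pair_pre_digraph \<Rightarrow> 'a \<Rightarrow> 'a \<Rightarrow> nat" where
  "detour_dist \<Gamma> u v = Max {length p | p. pre_digraph.apath (with_proj \<Gamma>) u p v}"

definition detour_ecc :: "'a pair_pre_digraph \<Rightarrow> 'a \<Rightarrow> nat" where
  "detour_ecc \<Gamma> u = Max (detour_dist \<Gamma> u ` pverts \<Gamma>)"

definition detour_count :: "'a pair_pre_digraph \<Rightarrow> 'a \<Rightarrow> nat \<Rightarrow> nat" where
  "detour_count \<Gamma> x i = card {v \<in> pverts \<Gamma>. detour_dist \<Gamma> x v = i}"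

definition vertex_dds :: "'a pair_pre_digraph \<Rightarrow> 'a \<Rightarrow> nat list" where
  "vertex_dds \<Gamma> x = map (detour_count \<Gamma> x) [0..<Suc (detour_ecc \<Gamma> x)]"

definition graph_dds :: "'a pair_pre_digraph \<Rightarrow> nat list multiset" where
  "graph_dds \<Gamma> = image_mset (vertex_dds \<Gamma>) (mset_set (pverts \<Gamma>))"

end

theory Submission
  imports Defs "HOL-Algebra.Multiplicative_Group"
begin

text \<open>
  Write \<open>z = a^(2n)\<close>. Every element of the semidihedral group is \<open>a^i\<close> or \<open>a^i b\<close>. The power
  \<open>a^i\<close> lies in \<open>\<langle>a\<rangle>\<close>; since \<open>(a^i b)^2 = a^(2ni)\<close>, the subgroup generated by
  \<open>a^i b\<close> is \<open>{e, a^i b}\<close> for even \<open>i\<close> and \<open>{e, z, a^i b, z a^i b}\<close> for odd \<open>i\<close>. Hence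
  the enhanced power graph is a clique on \<open>4n\<close> vertices with \<open>2n\<close> pendant vertices attached to
  \<open>e\<close> and \<open>n\<close> edges attached to both \<open>e\<close> and \<open>z\<close>. Locale \<open>hub_graph\<close> axiomatises this
  shape; lemma \<open>semidihedral_group_semidihedral\<close> shows that the presented group has the
  expected \<open>8n\<close> elements, and the sublocale declaration in \<open>semidihedral_group\<close>
  connects the two.

  Detour distances in such a graph are bounded by counting components. Deleting the hubs \<open>e\<close>
  and \<open>z\<close> leaves one component of size \<open>M = 4n - 2\<close>, further components of size 2, and the
  pendant vertices. A path can pass from one component to another only through a hub, and it
  visits each hub at most once. So it visits at most three components, one fewer for each of
  its ends that is a hub (\<open>card_components_visited\<close>), and at most two if its ends lie in the
  same component (\<open>card_components_visited_closed\<close>). As the visited components have at most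
  \<open>M + 2 + 2\<close> vertices in total, this bounds the length of every path. A path
  attaining the bound arises from a Hamiltonian path of a suitable part of the clique by
  appending pairs and pendant vertices at its ends (\<open>detour_through_clique\<close>). Only paths between
  pendant vertices and paths from \<open>e\<close> to a pendant vertex stay below the bound, since they are
  forced. Sorting the vertices by their distance from a given vertex then yields the sequences.
\<close>

section \<open>Detour distance via lists of vertices\<close>

text \<open>
  Arc lists are awkward to split at a vertex or to compare with vertex sets, so paths are
  represented by their lists of vertices; the number of edges is one less than the length.
\<close>

definition simple_path :: "'a pair_pre_digraph \<Rightarrow> 'a \<Rightarrow> 'a list \<Rightarrow> 'a \<Rightarrow> bool" where
  "simple_path \<Gamma> u xs v \<longleftrightarrow>
     xs \<noteq> [] \<and> hd xs = u \<and> last xs = v \<and> set xs \<subseteq> pverts \<Gamma> \<and> distinct xs \<and>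
     successively (\<lambda>x y. (x, y) \<in> parcs \<Gamma>) xs"

lemma awalk_with_proj_iff:
  "pre_digraph.awalk (with_proj \<Gamma>) u p v \<longleftrightarrow> u \<in> pverts \<Gamma> \<and> set p \<subseteq> parcs \<Gamma> \<and> pcas u p v"
  by (simp add: pre_digraph.awalk_def cas_with_proj_eq)

lemma apath_with_proj_iff:
  "pre_digraph.apath (with_proj \<Gamma>) u p v \<longleftrightarrow>
     u \<in> pverts \<Gamma> \<and> set p \<subseteq> parcs \<Gamma> \<and> pcas u p v \<and> distinct (pawalk_verts u p)"
  by (simp add: pre_digraph.apath_def awalk_with_proj_iff awalk_verts_with_proj_eq)

lemma simple_path_of_apath:
  assumes "parcs \<Gamma> \<subseteq> pverts \<Gamma> \<times> pverts \<Gamma>" "pre_digraph.apath (with_proj \<Gamma>) u p v"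
  shows "simple_path \<Gamma> u (pawalk_verts u p) v" "length (pawalk_verts u p) = Suc (length p)"
proof -
  have "u \<in> pverts \<Gamma>" "set p \<subseteq> parcs \<Gamma>" "pcas u p v" "distinct (pawalk_verts u p)"
    using assms(2) by (simp_all add: apath_with_proj_iff)
  then have "simple_path \<Gamma> u (pawalk_verts u p) v \<and> length (pawalk_verts u p) = Suc (length p)"
  proof (induction p arbitrary: u)
    case Nil
    then show ?case by (simp add: simple_path_def)
  next
    case (Cons c p)
    obtain w where c: "c = (u, w)" using Cons.prems by (cases c) auto
    have "w \<in> pverts \<Gamma>" using Cons.prems assms(1) c by auto
    then have "simple_path \<Gamma> w (pawalk_verts w p) v" "length (pawalk_verts w p) = Suc (length p)"
      using Cons c by auto
    then show ?case using Cons.prems c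
      by (cases "pawalk_verts w p") (auto simp: simple_path_def)
  qed
  then show "simple_path \<Gamma> u (pawalk_verts u p) v" "length (pawalk_verts u p) = Suc (length p)"
    by auto
qed

lemma apath_of_simple_path:
  assumes "simple_path \<Gamma> u xs v"
  obtains p where "pre_digraph.apath (with_proj \<Gamma>) u p v" "pawalk_verts u p = xs"
proof -
  have "\<exists>p. pre_digraph.apath (with_proj \<Gamma>) u p v \<and> pawalk_verts u p = xs"
    using assms
  proof (induction xs arbitrary: u)
    case Nil
    then show ?case by (simp add: simple_path_def)
  next
    case (Cons x xs)
    show ?case
    proof (cases xs)
      case Nil
      then show ?thesis using Cons.prems
        by (intro exI[of _ "[]"]) (auto simp: simple_path_def apath_with_proj_iff)
    next
      case (Cons y ys)
      with Cons.prems have "simple_path \<Gamma> y xs v" by (auto simp: simple_path_def)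
      then obtain p where "pre_digraph.apath (with_proj \<Gamma>) y p v" "pawalk_verts y p = xs"
        using Cons.IH by blast
      then show ?thesis using Cons Cons.prems
        by (intro exI[of _ "(x, y) # p"]) (auto simp: simple_path_def apath_with_proj_iff)
    qed
  qed
  then show thesis using that by blast
qed

lemma detour_dist_eqI:
  assumes "parcs \<Gamma> \<subseteq> pverts \<Gamma> \<times> pverts \<Gamma>"
    and "simple_path \<Gamma> u xs v" "length xs = Suc k"
    and bound: "\<And>ys. simple_path \<Gamma> u ys v \<Longrightarrow> length ys \<le> Suc k"
  shows "detour_dist \<Gamma> u v = k"
proof -
  let ?L = "{length p | p. pre_digraph.apath (with_proj \<Gamma>) u p v}"
  have le: "l \<le> k" if "l \<in> ?L" for l
    using that bound simple_path_of_apath[OF assms(1)] by force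
  obtain p where p: "pre_digraph.apath (with_proj \<Gamma>) u p v" "pawalk_verts u p = xs"
    using apath_of_simple_path[OF assms(2)] .
  with simple_path_of_apath(2)[OF assms(1) p(1)] assms(3) have "k \<in> ?L" by auto
  moreover have "finite ?L" using le by (meson finite_nat_set_iff_bounded_le)
  ultimately show ?thesis unfolding detour_dist_def using le by (intro Max_eqI) auto
qed

lemma detour_dist_self:
  assumes "parcs \<Gamma> \<subseteq> pverts \<Gamma> \<times> pverts \<Gamma>" "u \<in> pverts \<Gamma>"
  shows "detour_dist \<Gamma> u u = 0"
proof (rule detour_dist_eqI[OF assms(1), of _ "[u]"])
  fix ys assume "simple_path \<Gamma> u ys u"
  then show "length ys \<le> Suc 0"
    by (cases ys) (auto simp: simple_path_def split: if_splits)
qed (use assms in \<open>auto simp: simple_path_def\<close>)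

lemma simple_path_rev:
  assumes "sym (parcs \<Gamma>)" "simple_path \<Gamma> u xs v"
  shows "simple_path \<Gamma> v (rev xs) u"
proof -
  have "successively (\<lambda>x y. (y, x) \<in> parcs \<Gamma>) xs"
    using assms by (auto simp: simple_path_def dest: symD elim: successively_mono)
  then show ?thesis using assms(2)
    by (simp add: simple_path_def hd_rev last_rev)
qed

lemma detour_dist_commute:
  assumes "parcs \<Gamma> \<subseteq> pverts \<Gamma> \<times> pverts \<Gamma>" "sym (parcs \<Gamma>)"
  shows "detour_dist \<Gamma> u v = detour_dist \<Gamma> v u"
proof -
  have "\<exists>q. length q = length p \<and> pre_digraph.apath (with_proj \<Gamma>) v q u"
    if p: "pre_digraph.apath (with_proj \<Gamma>) u p v" for u p v
  proof -
    note sp = simple_path_of_apath[OF assms(1) p]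
    obtain q where q: "pre_digraph.apath (with_proj \<Gamma>) v q u"
      and qs: "pawalk_verts v q = rev (pawalk_verts u p)"
      using apath_of_simple_path[OF simple_path_rev[OF assms(2) sp(1)]] .
    have "length q = length p"
      using simple_path_of_apath(2)[OF assms(1) q] qs sp(2) by simp
    with q show ?thesis by blast
  qed
  then have "{length p | p. pre_digraph.apath (with_proj \<Gamma>) u p v} =
      {length p | p. pre_digraph.apath (with_proj \<Gamma>) v p u}"
    by (auto; metis)
  then show ?thesis by (simp add: detour_dist_def)
qed

text \<open>
  The eccentricity need not be computed separately: it is the last index at which the count of
  vertices is nonzero.
\<close>

lemma vertex_dds_eqI:
  assumes "finite (pverts \<Gamma>)" "xs \<noteq> []" "last xs \<noteq> 0"
    and count: "\<And>i. detour_count \<Gamma> x i = (if i < length xs then xs ! i else 0)"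
  shows "vertex_dds \<Gamma> x = xs"
proof -
  let ?k = "length xs - 1"
  have "detour_count \<Gamma> x ?k \<noteq> 0"
    using assms by (simp add: last_conv_nth)
  then obtain v where "v \<in> pverts \<Gamma>" "detour_dist \<Gamma> x v = ?k"
    unfolding detour_count_def by (metis (mono_tags, lifting) card.empty empty_Collect_eq)
  moreover have "detour_dist \<Gamma> x v \<le> ?k" if "v \<in> pverts \<Gamma>" for v
  proof (rule ccontr)
    assume "\<not> ?thesis"
    then have "detour_count \<Gamma> x (detour_dist \<Gamma> x v) = 0" using count by auto
    moreover have "v \<in> {w \<in> pverts \<Gamma>. detour_dist \<Gamma> x w = detour_dist \<Gamma> x v}" using that by simp
    ultimately show False using assms(1) by (auto simp: detour_count_def)
  qed
  ultimately have "detour_ecc \<Gamma> x = ?k"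
    unfolding detour_ecc_def using assms(1) by (intro Max_eqI) (auto intro: rev_image_eqI)
  then have "vertex_dds \<Gamma> x = map (detour_count \<Gamma> x) [0..<length xs]"
    using assms(2) by (simp add: vertex_dds_def del: upt_Suc)
  also have "\<dots> = xs" by (rule nth_equalityI) (simp_all add: count)
  finally show ?thesis .
qed

section \<open>Components visited by a path outside a separating set\<close>

text \<open>
  Between two components a path has to spend a vertex of the separating set \<open>S\<close>, like posts
  between fence panels: \<open>m\<close> panels need \<open>m - 1\<close> posts, and an additional post for each end of
  the path that lies in \<open>S\<close>. The map \<open>c\<close> labels each vertex outside \<open>S\<close> by its component.
\<close>

lemma card_components_visited:
  assumes "xs \<noteq> []" "distinct xs" "finite S"
    and "successively (\<lambda>x y. x \<in> S \<or> y \<in> S \<or> c x = c y) xs"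
  shows "card (c ` (set xs - S)) + of_bool (hd xs \<in> S) + of_bool (last xs \<in> S)
    \<le> card (set xs \<inter> S) + 1"
  using assms(1,2,4)
proof (induction xs rule: induct_list012)
  case (2 x)
  then show ?case by (cases "x \<in> S") (auto simp: insert_Diff_if)
next
  case (3 x y ys)
  let ?ys = "y # ys"
  have IH: "card (c ` (set ?ys - S)) + of_bool (y \<in> S) + of_bool (last ?ys \<in> S)
      \<le> card (set ?ys \<inter> S) + 1"
    using 3 by simp
  show ?case
  proof (cases "x \<in> S")
    case True
    have "card (insert x (set ?ys \<inter> S)) = Suc (card (set ?ys \<inter> S))"
      using 3 assms(3) by (intro card_insert_disjoint) auto
    moreover have "set (x # ?ys) - S = set ?ys - S" "set (x # ?ys) \<inter> S = insert x (set ?ys \<inter> S)"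
      using True by auto
    ultimately show ?thesis using IH True by simp
  next
    case x: False
    have *: "set (x # ?ys) - S = insert x (set ?ys - S)" "set (x # ?ys) \<inter> S = set ?ys \<inter> S"
      using x by auto
    show ?thesis
    proof (cases "y \<in> S")
      case True
      have "card (c ` (set (x # ?ys) - S)) \<le> Suc (card (c ` (set ?ys - S)))"
        unfolding * image_insert by (rule card_insert_le_m1) auto
      then show ?thesis unfolding *(2) using IH x True by simp
    next
      case False
      then have "c ` (set (x # ?ys) - S) = c ` (set ?ys - S)"
        unfolding * using x 3 by auto
      then show ?thesis unfolding *(2) using IH x False by simp
    qed
  qed
qed simp

text \<open>
  If a path that meets \<open>S\<close> starts and ends in the same component, this component occurs both
  before the first and after the last post, which saves one panel in
  \<open>card_components_visited\<close>.
\<close>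

lemma card_components_visited_closed:
  assumes "xs \<noteq> []" "distinct xs" "finite S"
    and "successively (\<lambda>x y. x \<in> S \<or> y \<in> S \<or> c x = c y) xs"
    and "hd xs \<notin> S" "last xs \<notin> S" "c (hd xs) = c (last xs)"
  shows "card (c ` (set xs - S)) \<le> max 1 (card (set xs \<inter> S))"
  using assms(1,2,4-)
proof (induction xs rule: induct_list012)
  case (3 x y ys)
  let ?ys = "y # ys"
  have *: "set (x # ?ys) - S = insert x (set ?ys - S)" "set (x # ?ys) \<inter> S = set ?ys \<inter> S"
    using 3 by auto
  have "c x \<in> c ` (set ?ys - S)"
    using 3 by (auto intro!: image_eqI[of _ _ "last ?ys"])
  then have D: "c ` (set (x # ?ys) - S) = c ` (set ?ys - S)"
    unfolding * by auto
  show ?case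
  proof (cases "y \<in> S")
    case True
    have "card (c ` (set ?ys - S)) + of_bool (y \<in> S) + of_bool (last ?ys \<in> S)
      \<le> card (set ?ys \<inter> S) + 1"
      using card_components_visited[of ?ys S c] 3 assms(3) by simp
    then show ?thesis unfolding D *(2) using True by simp
  next
    case False
    then have "card (c ` (set ?ys - S)) \<le> max 1 (card (set ?ys \<inter> S))"
      using 3 by (intro 3) auto
    then show ?thesis unfolding D *(2) .
  qed
qed (auto simp: insert_Diff_if)

section \<open>Graphs with two hubs\<close>

lemma card_level_const:
  assumes "\<And>v. v \<in> B \<Longrightarrow> f v = c"
  shows "card {v \<in> B. f v = i} = (if i = c then card B else 0)"
proof -
  have "{v \<in> B. f v = i} = (if i = c then B else {})" using assms by auto
  then show ?thesis by simp
qed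

text \<open>
  For the enhanced power graph of the semidihedral group these blocks are the maximal cyclic
  subgroups.
\<close>

definition hub_blocks :: "'a \<Rightarrow> 'a \<Rightarrow> 'a set \<Rightarrow> 'a set \<Rightarrow> 'a set \<Rightarrow> ('a \<Rightarrow> 'a) \<Rightarrow> 'a set set" where
  "hub_blocks e z A P Q mate =
     insert ({e, z} \<union> A) ((\<lambda>p. {e, p}) ` P \<union> (\<lambda>q. {e, z, q, mate q}) ` Q)"

text \<open>
  The hubs \<open>e\<close> and \<open>z\<close> form a clique together with \<open>A\<close>; vertices in \<open>P\<close> are pendant at \<open>e\<close>; the
  vertices in \<open>Q\<close> come in pairs, matched by \<open>mate\<close>, and each pair forms a clique with both hubs.
  The lower bounds on the sizes ensure that a detour through a pair is never longer than one
  through \<open>A\<close>, and that there are two different pairs.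
\<close>

locale hub_graph =
  fixes \<Gamma> :: "'a pair_pre_digraph" and e z :: 'a and A P Q :: "'a set" and mate :: "'a \<Rightarrow> 'a"
  assumes verts: "pverts \<Gamma> = {e, z} \<union> A \<union> P \<union> Q"
    and finites: "finite A" "finite P" "finite Q"
    and hubs: "e \<noteq> z" "e \<notin> A" "e \<notin> P" "e \<notin> Q" "z \<notin> A" "z \<notin> P" "z \<notin> Q"
    and disj: "A \<inter> P = {}" "A \<inter> Q = {}" "P \<inter> Q = {}"
    and mate: "\<And>q. q \<in> Q \<Longrightarrow> mate q \<in> Q" "\<And>q. q \<in> Q \<Longrightarrow> mate q \<noteq> q"
      "\<And>q. q \<in> Q \<Longrightarrow> mate (mate q) = q"
    and arcs: "\<And>x y. (x, y) \<in> parcs \<Gamma> \<longleftrightarrow> x \<noteq> y \<and> (\<exists>B\<in>hub_blocks e z A P Q mate. x \<in> B \<and> y \<in> B)"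
    and card_A: "2 \<le> card A" and P_ne: "P \<noteq> {}" and card_Q: "4 \<le> card Q"
begin

abbreviation "K \<equiv> {e, z} \<union> A"
abbreviation "M \<equiv> card A"
abbreviation "adj x y \<equiv> (x, y) \<in> parcs \<Gamma>"
abbreviation "D \<equiv> detour_dist \<Gamma>"

lemma adj_iff:
  "adj x y \<longleftrightarrow> x \<noteq> y \<and>
    (x \<in> K \<and> y \<in> K \<or> (\<exists>p\<in>P. x \<in> {e, p} \<and> y \<in> {e, p}) \<or>
     (\<exists>q\<in>Q. x \<in> {e, z, q, mate q} \<and> y \<in> {e, z, q, mate q}))"
  unfolding arcs hub_blocks_def by (simp add: bex_Un)

lemma arcs_verts: "parcs \<Gamma> \<subseteq> pverts \<Gamma> \<times> pverts \<Gamma>"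
proof -
  have "B \<subseteq> pverts \<Gamma>" if "B \<in> hub_blocks e z A P Q mate" for B
    using that mate(1) by (auto simp: hub_blocks_def verts)
  then show ?thesis by (intro subrelI) (metis arcs mem_Sigma_iff subsetD)
qed

lemma sym_arcs: "sym (parcs \<Gamma>)"
  by (auto simp: sym_def arcs)

lemma adj_clique: "x \<in> K \<Longrightarrow> y \<in> K \<Longrightarrow> x \<noteq> y \<Longrightarrow> adj x y"
  by (simp add: adj_iff)

lemma adj_pendant:
  assumes "p \<in> P"
  shows "adj p y \<longleftrightarrow> y = e" "adj y p \<longleftrightarrow> y = e"
proof -
  have *: "p \<noteq> e" "p \<noteq> z" "p \<notin> A" "\<And>q. q \<in> Q \<Longrightarrow> p \<noteq> q \<and> p \<noteq> mate q"
    using assms disj hubs mate(1) by auto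
  show "adj p y \<longleftrightarrow> y = e" using assms * unfolding adj_iff by auto
  then show "adj y p \<longleftrightarrow> y = e" using sym_arcs by (auto dest: symD)
qed

lemma adj_pair:
  assumes "q \<in> Q"
  shows "adj e q" "adj q e" "adj z q" "adj q z" "adj q (mate q)" "adj (mate q) q"
proof -
  have *: "{e, z, q, mate q} \<in> hub_blocks e z A P Q mate"
    using assms by (simp add: hub_blocks_def)
  have "q \<noteq> e" "q \<noteq> z" "mate q \<noteq> q" using assms hubs mate(2) by auto
  then show "adj e q" "adj q e" "adj z q" "adj q z" "adj q (mate q)" "adj (mate q) q"
    unfolding arcs by (auto intro!: bexI[OF _ *])
qed

text \<open>
  The vertex set of the connected component that contains \<open>x\<close> after removal of both hubs.
\<close>

definition component :: "'a \<Rightarrow> 'a set" where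
  "component x = (if x \<in> A then A else if x \<in> Q then {x, mate x} else {x})"

lemma component_eq_of_adj:
  assumes "adj x y" "x \<notin> {e, z}" "y \<notin> {e, z}"
  shows "component x = component y"
proof -
  consider "x \<in> A" "y \<in> A" | q where "q \<in> Q" "x \<in> {q, mate q}" "y \<in> {q, mate q}"
    using assms unfolding adj_iff by blast
  then show ?thesis
  proof cases
    case 2
    then have "x \<in> Q" "y \<in> Q" "mate (mate q) = q" using mate by auto
    then show ?thesis using 2 disj by (auto simp: component_def)
  qed (simp add: component_def)
qed

lemma successively_adj_component:
  assumes "successively adj xs"
  shows "successively (\<lambda>x y. x \<in> {e, z} \<or> y \<in> {e, z} \<or> component x = component y) xs"
  using assms by (rule successively_mono) (use component_eq_of_adj in auto)

text \<open>
  The summand for \<open>p\<close> records that the component of a pendant vertex misses the bound 2 by one;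
  this is what makes detours that end in a pendant vertex shorter.
\<close>

lemma card_component:
  assumes "x \<in> pverts \<Gamma> - {e, z}" "p \<in> P"
  shows "card (component x) + of_bool (component x = {p}) \<le> 2 + (if component x = A then M - 2 else 0)"
proof -
  have "A \<noteq> {p}" using assms disj by auto
  moreover have "{x, mate x} \<noteq> {p}" if "x \<in> Q" using that assms disj by auto
  moreover have "card {x, mate x} \<le> 2" by (simp add: card_insert_if)
  ultimately show ?thesis using card_A assms by (auto simp: component_def)
qed

text \<open>
  The vertices of a path outside the hubs lie in the union of the components it visits, and all
  components other than \<open>A\<close> have at most two vertices.
\<close>

lemma length_le_components:
  assumes "set xs \<subseteq> pverts \<Gamma>" "distinct xs" "p \<in> P"
  shows "length xs + of_bool (p \<in> set xs)
    \<le> card (set xs \<inter> {e, z}) + 2 * card (component ` (set xs - {e, z})) + (M - 2)"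
proof -
  let ?C = "component ` (set xs - {e, z})"
  have "set xs - {e, z} \<subseteq> \<Union> ?C" by (auto simp: component_def)
  moreover have fin: "finite (\<Union> ?C)" using finites by (auto simp: component_def)
  ultimately have "card (set xs - {e, z}) \<le> card (\<Union> ?C)" by (rule card_mono[rotated])
  also have "\<dots> \<le> sum card ?C"
    using fin by (intro card_Union_le_sum_card)
  finally have 1: "card (set xs - {e, z}) \<le> sum card ?C" .
  have "p \<noteq> e" "p \<noteq> z" "component p = {p}" using assms hubs disj by (auto simp: component_def)
  then have 2: "of_bool (p \<in> set xs) \<le> (\<Sum>B\<in>?C. of_bool (B = {p}) :: nat)"
    by (auto simp: of_bool_def sum.delta' image_iff)
  have "sum card ?C + (\<Sum>B\<in>?C. of_bool (B = {p})) \<le> (\<Sum>B\<in>?C. 2 + (if B = A then M - 2 else 0))"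
    unfolding sum.distrib[symmetric]
  proof (rule sum_mono)
    fix B assume "B \<in> ?C"
    then obtain x where "x \<in> pverts \<Gamma> - {e, z}" "B = component x" using assms by auto
    then show "card B + of_bool (B = {p}) \<le> 2 + (if B = A then M - 2 else 0)"
      using card_component assms by simp
  qed
  also have "\<dots> = 2 * card ?C + (if A \<in> ?C then M - 2 else 0)"
    unfolding sum.distrib by (simp add: sum.delta)
  also have "\<dots> \<le> 2 * card ?C + (M - 2)" by simp
  finally have 3: "sum card ?C + (\<Sum>B\<in>?C. of_bool (B = {p})) \<le> 2 * card ?C + (M - 2)" .
  have "length xs = card (set xs)" using assms by (simp add: distinct_card)
  also have "\<dots> = card (set xs \<inter> {e, z}) + card (set xs - {e, z})"
    by (rule card_Int_Diff[OF finite_set])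
  finally show ?thesis using 1 2 3 by linarith
qed

lemma card_hubs: "card (set xs \<inter> {e, z}) \<le> 2"
proof -
  have "card (set xs \<inter> {e, z}) \<le> card {e, z}" by (intro card_mono) auto
  then show ?thesis using hubs by simp
qed

text \<open>
  At most three components are visited, and one fewer for each end that is a hub. Each lost
  component costs two vertices.
\<close>

lemma simple_path_length_le:
  assumes "simple_path \<Gamma> u xs v" "p \<in> P"
  shows "length xs + of_bool (p \<in> set xs) + 2 * of_bool (u \<in> {e, z}) + 2 * of_bool (v \<in> {e, z})
    \<le> M + 6"
proof -
  have *: "xs \<noteq> []" "distinct xs" "set xs \<subseteq> pverts \<Gamma>" "hd xs = u" "last xs = v"
    "successively (\<lambda>x y. x \<in> {e, z} \<or> y \<in> {e, z} \<or> component x = component y) xs"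
    using assms successively_adj_component by (auto simp: simple_path_def)
  show ?thesis
    using card_components_visited[OF *(1,2) _ *(6)] length_le_components[OF *(3,2) assms(2)]
      card_hubs[of xs] card_A unfolding *(4,5) by simp
qed

text \<open>
  Here at most two components are visited, and hence at most \<open>2 + M + 2\<close> vertices.
\<close>

lemma simple_path_length_le_closed:
  assumes "simple_path \<Gamma> u xs v" "u \<notin> {e, z}" "v \<notin> {e, z}" "component u = component v"
  shows "length xs \<le> M + 4"
proof -
  have *: "xs \<noteq> []" "distinct xs" "set xs \<subseteq> pverts \<Gamma>" "hd xs = u" "last xs = v"
    "successively (\<lambda>x y. x \<in> {e, z} \<or> y \<in> {e, z} \<or> component x = component y) xs"
    using assms successively_adj_component by (auto simp: simple_path_def)
  obtain p where "p \<in> P" using P_ne by auto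
  then show ?thesis
    using card_components_visited_closed[OF *(1,2) _ *(6)] length_le_components[OF *(3,2), of p]
      card_hubs[of xs] card_A assms unfolding *(4,5) by simp
qed

lemma successively_clique:
  assumes "distinct xs" "set xs \<subseteq> K"
  shows "successively adj xs"
  using assms by (induction xs rule: induct_list012) (auto intro: adj_clique)

lemma clique_path:
  assumes "B \<subseteq> K" "u \<in> B" "v \<in> B" "u \<noteq> v"
  obtains xs where "xs \<noteq> []" "hd xs = u" "last xs = v" "set xs = B" "distinct xs" "length xs = card B"
    "successively adj xs"
proof -
  have fin: "finite B" using assms(1) finites finite_subset by auto
  obtain ys where ys: "set ys = B - {u, v}" "distinct ys"
    using finite_distinct_list[of "B - {u, v}"] fin by auto
  let ?xs = "u # ys @ [v]"
  have xs: "set ?xs = B" "distinct ?xs" using ys assms by auto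
  show thesis
  proof (rule that[of ?xs])
    show "length ?xs = card B" using distinct_card[OF xs(2)] xs(1) by simp
    show "successively adj ?xs"
      by (rule successively_clique[OF xs(2)]) (simp only: xs(1) assms(1))
  qed (use xs in auto)
qed

subsection \<open>Detour distances\<close>

lemma pair_facts:
  assumes "q \<in> Q"
  shows "q \<in> pverts \<Gamma>" "q \<noteq> e" "q \<noteq> z" "q \<notin> A" "q \<notin> P"
    "mate q \<in> pverts \<Gamma>" "mate q \<noteq> e" "mate q \<noteq> z" "mate q \<notin> A" "mate q \<notin> P"
    "mate q \<in> Q" "mate q \<noteq> q" "mate (mate q) = q"
    "adj e (mate q)" "adj (mate q) e" "adj z (mate q)" "adj (mate q) z"
    "component q = {q, mate q}" "component (mate q) = {q, mate q}"
  using mate[OF assms] assms disj hubs adj_pair[OF mate(1)[OF assms]]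
  by (auto simp: verts component_def)

lemma pendant_facts:
  assumes "p \<in> P"
  shows "p \<in> pverts \<Gamma>" "p \<noteq> e" "p \<noteq> z" "p \<notin> A" "p \<notin> Q"
  using assms disj hubs by (auto simp: verts)

lemma clique_facts:
  assumes "a \<in> A"
  shows "a \<in> pverts \<Gamma>" "a \<noteq> e" "a \<noteq> z" "a \<notin> P" "a \<notin> Q" "component a = A"
    "adj e a" "adj a e" "adj z a" "adj a z"
  using assms disj hubs by (auto simp: verts component_def intro!: adj_clique)

lemma clique_verts: "K \<subseteq> pverts \<Gamma>" "e \<in> pverts \<Gamma>" "z \<in> pverts \<Gamma>" "A \<subseteq> pverts \<Gamma>"
  by (auto simp: verts)

lemma card_K: "card K = M + 2" "card (K - {e}) = M + 1" "card (K - {z}) = M + 1"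
  using hubs finites by (simp_all add: card_Diff_singleton_if)

lemma other_pair:
  assumes "q \<in> Q"
  obtains r where "r \<in> Q" "r \<noteq> q" "r \<noteq> mate q" "mate r \<noteq> q" "mate r \<noteq> mate q"
proof -
  have "card {q, mate q} < card Q" using card_Q by (auto simp: card_insert_if)
  then have "\<not> Q \<subseteq> {q, mate q}" using card_mono[of "{q, mate q}" Q] by auto
  then obtain r where r: "r \<in> Q" "r \<noteq> q" "r \<noteq> mate q" by blast
  moreover have "mate r \<noteq> q" "mate r \<noteq> mate q" using r assms mate(3) by metis+
  ultimately show thesis using that by blast
qed

lemma commute: "D u v = D v u"
  using detour_dist_commute[OF arcs_verts sym_arcs] .

lemma D_self: "u \<in> pverts \<Gamma> \<Longrightarrow> D u u = 0"
  using detour_dist_self[OF arcs_verts] .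

text \<open>
  Every longest path below follows this pattern: a Hamiltonian path from \<open>s\<close> to \<open>t\<close> of a part \<open>B\<close>
  of the central clique, with a few vertices (\<open>pre\<close> and \<open>post\<close>) attached at its ends. Given a
  matching upper bound, it determines the detour distance of its end vertices.
\<close>

lemma detour_through_clique:
  assumes bound: "\<And>ys. simple_path \<Gamma> u ys v \<Longrightarrow> length ys \<le> Suc k"
    and B: "B \<subseteq> K" "s \<in> B" "t \<in> B" "s \<noteq> t"
    and out: "set (pre @ post) \<subseteq> pverts \<Gamma> - B" "distinct (pre @ post)"
    and walk: "successively adj (pre @ [s])" "successively adj (t # post)"
    and ends: "u = hd (pre @ [s])" "v = last (t # post)"
    and len: "length (pre @ post) + card B = Suc k"
  shows "D u v = k"
proof -
  obtain xs where xs: "xs \<noteq> []" "hd xs = s" "last xs = t" "set xs = B" "distinct xs"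
    "length xs = card B" "successively adj xs"
    using clique_path[OF B] .
  have "B \<subseteq> pverts \<Gamma>" using B(1) by (auto simp: verts)
  then have "set (pre @ xs @ post) \<subseteq> pverts \<Gamma>" "distinct (pre @ xs @ post)"
    using xs(4,5) out by auto
  moreover have "hd (pre @ xs @ post) = u" "last (pre @ xs @ post) = v"
    using xs(1-3) ends by (auto simp: hd_append last_append)
  moreover have "successively adj (pre @ xs @ post)"
    using xs(1-3,7) walk by (auto simp: successively_append_iff successively_Cons)
  ultimately have "simple_path \<Gamma> u (pre @ xs @ post) v"
    using xs(1) by (simp add: simple_path_def)
  then show ?thesis
    by (rule detour_dist_eqI[OF arcs_verts _ _ bound]) (use xs(6) len in auto)
qed

text \<open>
  A path that ends in a pendant vertex spends one of its components on a single vertex.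
\<close>

lemma bound_to_pendant:
  assumes "simple_path \<Gamma> u xs p" "p \<in> P"
  shows "length xs + 2 * of_bool (u \<in> {e, z}) \<le> M + 5"
proof -
  have "p \<in> set xs" using assms(1) by (auto simp: simple_path_def)
  then show ?thesis using simple_path_length_le[OF assms] by simp
qed

lemma simple_path_length_bound:
  assumes "simple_path \<Gamma> u xs v"
  shows "length xs + 2 * of_bool (u \<in> {e, z}) + 2 * of_bool (v \<in> {e, z}) \<le> M + 6"
proof -
  obtain p where "p \<in> P" using P_ne by blast
  then show ?thesis using simple_path_length_le[OF assms] by fastforce
qed

lemma D_hubs: "D e z = M + 1"
  by (rule detour_through_clique[of e z _ K e z "[]" "[]"])
    (use hubs card_K in \<open>auto dest: simple_path_length_bound\<close>)

lemma D_hub_clique: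
  assumes a: "a \<in> A"
  shows "D e a = M + 3" "D z a = M + 3"
proof -
  obtain q where q: "q \<in> Q" using card_Q by fastforce
  note facts = hubs a clique_facts[OF a] q pair_facts[OF q] adj_pair[OF q]
  have "length ys \<le> Suc (M + 3)" if "simple_path \<Gamma> e ys a" for ys
    using simple_path_length_bound[OF that] facts by simp
  then show "D e a = M + 3"
    by (rule detour_through_clique[of _ _ _ "K - {e}" z a "[e, q, mate q]" "[]"])
      (use facts clique_verts card_K in auto)
  have "length ys \<le> Suc (M + 3)" if "simple_path \<Gamma> z ys a" for ys
    using simple_path_length_bound[OF that] facts by simp
  then show "D z a = M + 3"
    by (rule detour_through_clique[of _ _ _ "K - {z}" e a "[z, q, mate q]" "[]"])
      (use facts clique_verts card_K in auto)
qed

lemma D_hub_pair: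
  assumes q: "q \<in> Q"
  shows "D e q = M + 3" "D z q = M + 3"
proof -
  note facts = hubs q pair_facts[OF q] adj_pair[OF q]
  have "length ys \<le> Suc (M + 3)" if "simple_path \<Gamma> e ys q" for ys
    using simple_path_length_bound[OF that] facts by simp
  then show "D e q = M + 3"
    by (rule detour_through_clique[of _ _ _ "K" e z "[]" "[mate q, q]"])
      (use facts clique_verts card_K in auto)
  have "length ys \<le> Suc (M + 3)" if "simple_path \<Gamma> z ys q" for ys
    using simple_path_length_bound[OF that] facts by simp
  then show "D z q = M + 3"
    by (rule detour_through_clique[of _ _ _ "K" z e "[]" "[mate q, q]"])
      (use facts clique_verts card_K in auto)
qed

lemma simple_path_from_pendant:
  assumes "p \<in> P" "simple_path \<Gamma> p xs v" "v \<noteq> p"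
  obtains ys where "xs = p # e # ys"
proof -
  from assms obtain y ys where "xs = p # y # ys"
    by (cases xs; cases "tl xs") (auto simp: simple_path_def)
  with assms that show thesis by (auto simp: simple_path_def adj_pendant(1))
qed

lemma D_pendant_e:
  assumes p: "p \<in> P"
  shows "D p e = 1"
proof (rule detour_dist_eqI[OF arcs_verts, of _ "[p, e]"])
  fix ys assume ys: "simple_path \<Gamma> p ys e"
  then obtain zs where "ys = p # e # zs"
    using simple_path_from_pendant[OF p] pendant_facts(2)[OF p] by metis
  with ys show "length ys \<le> Suc 1"
    by (cases zs rule: rev_cases) (auto simp: simple_path_def)
qed (use pendant_facts[OF p] adj_pendant[OF p] clique_verts in \<open>auto simp: simple_path_def\<close>)

text \<open>
  Pendant vertices are adjacent to \<open>e\<close> only, so a path between two of them has no freedom.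
\<close>

lemma D_pendants:
  assumes p: "p \<in> P" and p': "p' \<in> P" and ne: "p \<noteq> p'"
  shows "D p p' = 2"
proof (rule detour_dist_eqI[OF arcs_verts, of _ "[p, e, p']"])
  fix ys assume ys: "simple_path \<Gamma> p ys p'"
  obtain zs where zs: "ys = p # e # zs"
    using simple_path_from_pendant[OF p ys] ne by metis
  obtain ws where "rev ys = p' # e # ws"
    using simple_path_from_pendant[OF p' simple_path_rev[OF sym_arcs ys] ne] .
  then have ws: "ys = rev ws @ [e, p']" by (simp add: rev_swap)
  have "distinct ys" using ys by (simp add: simple_path_def)
  then have "rev ws = [p]"
    using zs unfolding ws by (cases "rev ws"; cases "tl (rev ws)") auto
  then show "length ys \<le> Suc 2" using ws by simp
qed (use pendant_facts[OF p] adj_pendant[OF p] pendant_facts[OF p'] adj_pendant[OF p'] ne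
    clique_verts in \<open>auto simp: simple_path_def\<close>)

lemma D_z_pendant:
  assumes p: "p \<in> P"
  shows "D z p = M + 2"
proof -
  note facts = hubs p pendant_facts[OF p] adj_pendant[OF p]
  have "length ys \<le> Suc (M + 2)" if "simple_path \<Gamma> z ys p" for ys
    using bound_to_pendant[OF that p] facts by simp
  then show "D z p = M + 2"
    by (rule detour_through_clique[of _ _ _ "K" z e "[]" "[p]"])
      (use facts clique_verts card_K in auto)
qed

lemma D_clique_pendant:
  assumes a: "a \<in> A" and p: "p \<in> P"
  shows "D a p = M + 4"
proof -
  obtain q where q: "q \<in> Q" using card_Q by fastforce
  note facts = hubs a clique_facts[OF a] p pendant_facts[OF p] adj_pendant[OF p] q pair_facts[OF q] adj_pair[OF q]
  have "length ys \<le> Suc (M + 4)" if "simple_path \<Gamma> a ys p" for ys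
    using bound_to_pendant[OF that p] facts by simp
  then show "D a p = M + 4"
    by (rule detour_through_clique[of _ _ _ "K - {e}" a z "[]" "[q, mate q, e, p]"])
      (use facts clique_verts card_K in auto)
qed

lemma D_pair_pendant:
  assumes q: "q \<in> Q" and p: "p \<in> P"
  shows "D q p = M + 4"
proof -
  note facts = hubs p pendant_facts[OF p] adj_pendant[OF p] q pair_facts[OF q] adj_pair[OF q]
  have "length ys \<le> Suc (M + 4)" if "simple_path \<Gamma> q ys p" for ys
    using bound_to_pendant[OF that p] facts by simp
  then show "D q p = M + 4"
    by (rule detour_through_clique[of _ _ _ "K" z e "[q, mate q]" "[p]"])
      (use facts clique_verts card_K in auto)
qed

lemma D_clique:
  assumes a: "a \<in> A" and a': "a' \<in> A" and ne: "a \<noteq> a'"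
  shows "D a a' = M + 3"
proof -
  obtain q where q: "q \<in> Q" using card_Q by fastforce
  (* The path leaves the clique through e and returns through z directly to a', so both z and a' have to be kept out of its first part. *)
  have "card (K - {z} - {a'}) = M"
    using card_K a' finites clique_facts(2,3)[OF a'] by (subst card_Diff_singleton) auto
  then have B: "card (K - {z, a'}) = M" by (simp only: Diff_insert2[of K z "{a'}"])
  note facts = B ne hubs a clique_facts[OF a] a' clique_facts[OF a'] q pair_facts[OF q] adj_pair[OF q]
  have "length ys \<le> Suc (M + 3)" if "simple_path \<Gamma> a ys a'" for ys
    using simple_path_length_le_closed[OF that] facts by simp
  then show "D a a' = M + 3"
    by (rule detour_through_clique[of _ _ _ "K - {z, a'}" a e "[]" "[q, mate q, z, a']"])
      (use facts clique_verts card_K in auto)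
qed

lemma D_clique_pair:
  assumes a: "a \<in> A" and q: "q \<in> Q"
  shows "D a q = M + 5"
proof -
  (* A second pair is needed to pass from e to z, since the pair of q comes last. *)
  obtain r where r: "r \<in> Q" "r \<noteq> q" "r \<noteq> mate q" "mate r \<noteq> q" "mate r \<noteq> mate q"
    using other_pair[OF q] .
  note facts = hubs a clique_facts[OF a] q pair_facts[OF q] adj_pair[OF q] r pair_facts[OF r(1)] adj_pair[OF r(1)]
  have "length ys \<le> Suc (M + 5)" if "simple_path \<Gamma> a ys q" for ys
    using simple_path_length_bound[OF that] facts by simp
  then show "D a q = M + 5"
    by (rule detour_through_clique[of _ _ _ "K - {z}" a e "[]" "[r, mate r, z, mate q, q]"])
      (use facts clique_verts card_K in auto)
qed

lemma D_mates:
  assumes q: "q \<in> Q"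
  shows "D q (mate q) = M + 3"
proof -
  note facts = hubs q pair_facts[OF q] adj_pair[OF q]
  have "length ys \<le> Suc (M + 3)" if "simple_path \<Gamma> q ys (mate q)" for ys
    using simple_path_length_le_closed[OF that] facts by simp
  then show "D q (mate q) = M + 3"
    by (rule detour_through_clique[of _ _ _ "K" e z "[q]" "[mate q]"])
      (use facts clique_verts card_K in auto)
qed

lemma D_pairs:
  assumes q: "q \<in> Q" and r: "r \<in> Q" and ne: "r \<noteq> q" "r \<noteq> mate q"
  shows "D q r = M + 5"
proof -
  have ne': "mate r \<noteq> q" "mate r \<noteq> mate q" using q r ne mate(3) by metis+
  note facts = ne ne' hubs q pair_facts[OF q] adj_pair[OF q] r pair_facts[OF r] adj_pair[OF r]
  have "length ys \<le> Suc (M + 5)" if "simple_path \<Gamma> q ys r" for ys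
    using simple_path_length_bound[OF that] facts by simp
  then show "D q r = M + 5"
    by (rule detour_through_clique[of _ _ _ "K" e z "[q, mate q]" "[mate r, r]"])
      (use facts clique_verts card_K in auto)
qed

subsection \<open>Degree sequences\<close>

lemmas D_values = D_hubs D_hub_clique D_hub_pair D_pendant_e D_z_pendant
  D_clique_pendant D_pair_pendant D_clique_pair
lemmas D_values_sym = D_values[THEN HOL.trans[OF commute]]

lemma finite_verts: "finite (pverts \<Gamma>)"
  using finites by (simp add: verts)

lemma detour_count_split:
  "detour_count \<Gamma> x i = of_bool (i = D x e) + of_bool (i = D x z) +
     card {v \<in> A. D x v = i} + card {v \<in> P. D x v = i} + card {v \<in> Q. D x v = i}"
proof -
  have *: "card {v \<in> B. D x v = i} = (\<Sum>v\<in>B. of_bool (D x v = i))" if "finite B" for B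
    using that by (simp add: Int_def conj_commute)
  have "(\<Sum>v\<in>pverts \<Gamma>. of_bool (D x v = i) :: nat) = (\<Sum>v\<in>{e, z}. of_bool (D x v = i))
    + (\<Sum>v\<in>A. of_bool (D x v = i)) + (\<Sum>v\<in>P. of_bool (D x v = i)) + (\<Sum>v\<in>Q. of_bool (D x v = i))"
    unfolding verts using finites hubs disj
    by (subst sum.union_disjoint; (subst sum.union_disjoint)?; (subst sum.union_disjoint)?) auto
  also have "(\<Sum>v\<in>{e, z}. of_bool (D x v = i) :: nat) = of_bool (i = D x e) + of_bool (i = D x z)"
    using hubs by (simp add: eq_commute)
  finally show ?thesis
    unfolding detour_count_def using finites finite_verts by (simp only: *)
qed

lemma card_level_clique:
  assumes "a \<in> A"
  shows "card {v \<in> A. D a v = i} = of_bool (i = 0) + (if i = M + 3 then M - 1 else 0)"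
proof -
  have "D a v = (if v = a then 0 else M + 3)" if "v \<in> A" for v
    using D_self clique_facts(1) D_clique[OF assms that] assms by simp
  then have "{v \<in> A. D a v = i} = {v \<in> A. (if v = a then 0 else M + 3) = i}"
    by (intro Collect_cong conj_cong) simp_all
  also have "\<dots> = (if i = 0 then {a} else if i = M + 3 then A - {a} else {})"
    using assms by auto
  finally show ?thesis using assms finites by simp
qed

lemma card_level_pendants:
  assumes "p \<in> P"
  shows "card {v \<in> P. D p v = i} = of_bool (i = 0) + (if i = 2 then card P - 1 else 0)"
proof -
  have "D p v = (if v = p then 0 else 2)" if "v \<in> P" for v
    using D_self pendant_facts(1) D_pendants[OF assms that] assms by simp
  then have "{v \<in> P. D p v = i} = {v \<in> P. (if v = p then 0 else 2) = i}"
    by (intro Collect_cong conj_cong) simp_all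
  also have "\<dots> = (if i = 0 then {p} else if i = 2 then P - {p} else {})"
    using assms by auto
  finally show ?thesis using assms finites by simp
qed

lemma card_level_pairs:
  assumes q: "q \<in> Q"
  shows "card {v \<in> Q. D q v = i} =
    of_bool (i = 0) + of_bool (i = M + 3) + (if i = M + 5 then card Q - 2 else 0)"
proof -
  have "D q q = 0" using D_self pair_facts(1)[OF q] .
  then have "D q v = (if v = q then 0 else if v = mate q then M + 3 else M + 5)" if "v \<in> Q" for v
    using D_mates[OF q] D_pairs[OF q that] by simp
  then have "{v \<in> Q. D q v = i} =
      {v \<in> Q. (if v = q then 0 else if v = mate q then M + 3 else M + 5) = i}"
    by (intro Collect_cong conj_cong) simp_all
  also have "\<dots> = (if i = 0 then {q} else if i = M + 3 then {mate q}
      else if i = M + 5 then Q - {q, mate q} else {})"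
    using q pair_facts(11,12)[OF q] by auto
  finally have "{v \<in> Q. D q v = i} = \<dots>" .
  moreover have "card (Q - {q, mate q}) = card Q - 2"
    using q pair_facts(11,12)[OF q] by (subst card_Diff_subset) auto
  ultimately show ?thesis by auto
qed

lemma vertex_dds_e:
  "vertex_dds \<Gamma> e = [1, card P] @ replicate (M - 1) 0 @ [1, 0, M + card Q]"
proof (rule vertex_dds_eqI[OF finite_verts])
  fix i
  have "card {v \<in> A. D e v = i} = (if i = M + 3 then M else 0)"
    "card {v \<in> P. D e v = i} = (if i = 1 then card P else 0)"
    "card {v \<in> Q. D e v = i} = (if i = M + 3 then card Q else 0)"
    by (rule card_level_const, simp add: D_values D_values_sym)+
  then have "detour_count \<Gamma> e i = of_bool (i = 0) + of_bool (i = M + 1)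
      + (if i = M + 3 then M else 0) + (if i = 1 then card P else 0) + (if i = M + 3 then card Q else 0)"
    unfolding detour_count_split using D_self[of e] D_hubs clique_verts by simp
  also have "\<dots> = (if i < length ([1, card P] @ replicate (M - 1) 0 @ [1, 0, M + card Q])
      then ([1, card P] @ replicate (M - 1) 0 @ [1, 0, M + card Q]) ! i else 0)"
    using card_A by (auto simp: nth_append nth_Cons')
  finally show "detour_count \<Gamma> e i = \<dots>" .
qed (use card_A in auto)

lemma vertex_dds_z:
  "vertex_dds \<Gamma> z = [1] @ replicate M 0 @ [1, card P, M + card Q]"
proof (rule vertex_dds_eqI[OF finite_verts])
  fix i
  have "card {v \<in> A. D z v = i} = (if i = M + 3 then M else 0)"
    "card {v \<in> P. D z v = i} = (if i = M + 2 then card P else 0)"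
    "card {v \<in> Q. D z v = i} = (if i = M + 3 then card Q else 0)"
    by (rule card_level_const, simp add: D_values D_values_sym)+
  then have "detour_count \<Gamma> z i = of_bool (i = M + 1) + of_bool (i = 0)
      + (if i = M + 3 then M else 0) + (if i = M + 2 then card P else 0) + (if i = M + 3 then card Q else 0)"
    unfolding detour_count_split using D_self[of z] clique_verts by (simp add: D_values_sym)
  also have "\<dots> = (if i < length ([1] @ replicate M 0 @ [1, card P, M + card Q])
      then ([1] @ replicate M 0 @ [1, card P, M + card Q]) ! i else 0)"
    using card_A by (auto simp: nth_append nth_Cons')
  finally show "detour_count \<Gamma> z i = \<dots>" .
qed (use card_A in auto)

lemma vertex_dds_clique:
  assumes a: "a \<in> A"
  shows "vertex_dds \<Gamma> a = [1] @ replicate (M + 2) 0 @ [M + 1, card P, card Q]"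
proof (rule vertex_dds_eqI[OF finite_verts])
  fix i
  have "card {v \<in> P. D a v = i} = (if i = M + 4 then card P else 0)"
    "card {v \<in> Q. D a v = i} = (if i = M + 5 then card Q else 0)"
    by (rule card_level_const, simp add: D_values D_values_sym a)+
  then have "detour_count \<Gamma> a i = of_bool (i = M + 3) + of_bool (i = M + 3)
      + (of_bool (i = 0) + (if i = M + 3 then M - 1 else 0))
      + (if i = M + 4 then card P else 0) + (if i = M + 5 then card Q else 0)"
    unfolding detour_count_split card_level_clique[OF a]
    by (simp add: D_values_sym a)
  also have "\<dots> = (if i < length ([1] @ replicate (M + 2) 0 @ [M + 1, card P, card Q])
      then ([1] @ replicate (M + 2) 0 @ [M + 1, card P, card Q]) ! i else 0)"
    using card_A by (auto simp: nth_append nth_Cons')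
  finally show "detour_count \<Gamma> a i = \<dots>" .
qed (use card_Q in auto)

lemma vertex_dds_pendant:
  assumes p: "p \<in> P"
  shows "vertex_dds \<Gamma> p = [1, 1, card P - 1] @ replicate (M - 1) 0 @ [1, 0, M + card Q]"
proof (rule vertex_dds_eqI[OF finite_verts])
  fix i
  have "card {v \<in> A. D p v = i} = (if i = M + 4 then M else 0)"
    "card {v \<in> Q. D p v = i} = (if i = M + 4 then card Q else 0)"
    by (rule card_level_const, simp add: D_values D_values_sym p)+
  then have "detour_count \<Gamma> p i = of_bool (i = 1) + of_bool (i = M + 2)
      + (if i = M + 4 then M else 0)
      + (of_bool (i = 0) + (if i = 2 then card P - 1 else 0)) + (if i = M + 4 then card Q else 0)"
    unfolding detour_count_split card_level_pendants[OF p]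
    by (simp add: D_values D_values_sym p)
  also have "\<dots> = (if i < length ([1, 1, card P - 1] @ replicate (M - 1) 0 @ [1, 0, M + card Q])
      then ([1, 1, card P - 1] @ replicate (M - 1) 0 @ [1, 0, M + card Q]) ! i else 0)"
    using card_A by (auto simp: nth_append nth_Cons')
  finally show "detour_count \<Gamma> p i = \<dots>" .
qed (use card_A in auto)

lemma vertex_dds_pair:
  assumes q: "q \<in> Q"
  shows "vertex_dds \<Gamma> q = [1] @ replicate (M + 2) 0 @ [3, card P, M + card Q - 2]"
proof (rule vertex_dds_eqI[OF finite_verts])
  fix i
  have "card {v \<in> A. D q v = i} = (if i = M + 5 then M else 0)"
    "card {v \<in> P. D q v = i} = (if i = M + 4 then card P else 0)"
    by (rule card_level_const, simp add: D_values D_values_sym q)+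
  then have "detour_count \<Gamma> q i = of_bool (i = M + 3) + of_bool (i = M + 3)
      + (if i = M + 5 then M else 0) + (if i = M + 4 then card P else 0)
      + (of_bool (i = 0) + of_bool (i = M + 3) + (if i = M + 5 then card Q - 2 else 0))"
    unfolding detour_count_split card_level_pairs[OF q]
    by (simp add: D_values_sym q)
  also have "\<dots> = (if i < length ([1] @ replicate (M + 2) 0 @ [3, card P, M + card Q - 2])
      then ([1] @ replicate (M + 2) 0 @ [3, card P, M + card Q - 2]) ! i else 0)"
    using card_Q by (auto simp: nth_append nth_Cons')
  finally show "detour_count \<Gamma> q i = \<dots>" .
qed (use card_A card_Q in auto)

theorem graph_dds_hub_graph:
  "graph_dds \<Gamma> =
      {# [1, card P] @ replicate (M - 1) 0 @ [1, 0, M + card Q] #}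
    + {# [1] @ replicate M 0 @ [1, card P, M + card Q] #}
    + replicate_mset M ([1] @ replicate (M + 2) 0 @ [M + 1, card P, card Q])
    + replicate_mset (card P) ([1, 1, card P - 1] @ replicate (M - 1) 0 @ [1, 0, M + card Q])
    + replicate_mset (card Q) ([1] @ replicate (M + 2) 0 @ [3, card P, M + card Q - 2])"
proof -
  have "mset_set (pverts \<Gamma>) = {#e#} + {#z#} + mset_set A + mset_set P + mset_set Q"
    unfolding verts using finites hubs disj
    by (subst mset_set_Union; (subst mset_set_Union)?; (subst mset_set_Union)?) auto
  moreover have "image_mset (vertex_dds \<Gamma>) (mset_set B) = replicate_mset (card B) s"
    if "\<And>v. v \<in> B \<Longrightarrow> vertex_dds \<Gamma> v = s" "finite B" for B s
  proof -
    have "image_mset (vertex_dds \<Gamma>) (mset_set B) = image_mset (\<lambda>_. s) (mset_set B)"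
      using that by (intro image_mset_cong) simp
    then show ?thesis by (simp add: image_mset_const_eq)
  qed
  ultimately show ?thesis
    unfolding graph_dds_def
    by (simp only: image_mset_union image_mset_single vertex_dds_e vertex_dds_z
        vertex_dds_clique vertex_dds_pendant vertex_dds_pair finites)
qed

end

section \<open>Cyclic subgroups of semidihedral groups\<close>

lemma range_periodic:
  fixes f :: "nat \<Rightarrow> 'a"
  assumes "0 < m" "\<And>k. f (k mod m) = f k"
  shows "range f = f ` {..<m}"
proof -
  have "f k \<in> f ` {..<m}" for k
    using assms(1) assms(2)[of k, symmetric] by (intro image_eqI[of _ _ "k mod m"]) simp_all
  then show ?thesis by blast
qed

lemma (in group) pow_mod_of_pow_eq_one:
  assumes "x \<in> carrier G" "x [^] (m::nat) = \<one>"
  shows "x [^] (k mod m) = x [^] k"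
proof -
  have "x [^] k = x [^] (m * (k div m) + k mod m)" by simp
  also have "\<dots> = (x [^] m) [^] (k div m) \<otimes> x [^] (k mod m)"
    using assms(1) by (simp only: nat_pow_mult nat_pow_pow)
  finally show ?thesis using assms by simp
qed

lemma (in group) generate_of_pow_eq_one:
  assumes x: "x \<in> carrier G" "x [^] (m::nat) = \<one>" "0 < m"
  shows "generate G {x} = (\<lambda>k. x [^] k) ` {..<m}"
proof -
  have "ord x \<noteq> 0" using x pow_eq_id by fastforce
  then have "generate G {x} = range (\<lambda>k::nat. x [^] k)"
    using generate_pow_nat[OF x(1)] by auto
  also have "\<dots> = (\<lambda>k. x [^] k) ` {..<m}"
    using x(3) pow_mod_of_pow_eq_one[OF x(1,2)] by (rule range_periodic)
  finally show ?thesis .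
qed

text \<open>
  The defining relations alone leave open whether \<open>a\<close> and \<open>b\<close> generate a proper quotient of the
  semidihedral group. They suffice for all computations with normal forms.
\<close>

locale semidihedral_relations = group G for G (structure) +
  fixes n :: nat and a b :: 'a
  assumes n_pos: "0 < n"
    and a_closed [simp]: "a \<in> carrier G" and b_closed [simp]: "b \<in> carrier G"
    and a_order: "a [^] (4 * n) = \<one>" and b_order: "b \<otimes> b = \<one>"
    and b_a: "b \<otimes> a = a [^] (2 * n - 1) \<otimes> b"
begin

lemma b_pow: "b \<otimes> a [^] (i::nat) = a [^] ((2 * n - 1) * i) \<otimes> b"
proof (induction i)
  case (Suc i)
  have "b \<otimes> a [^] Suc i = (b \<otimes> a [^] i) \<otimes> a" by (simp add: m_assoc)
  also have "\<dots> = a [^] ((2 * n - 1) * i) \<otimes> (b \<otimes> a)" by (simp add: Suc m_assoc)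
  also have "\<dots> = a [^] ((2 * n - 1) * i) \<otimes> a [^] (2 * n - 1) \<otimes> b" by (simp add: b_a m_assoc)
  also have "\<dots> = a [^] ((2 * n - 1) * Suc i) \<otimes> b" by (simp add: nat_pow_mult add.commute)
  finally show ?case .
qed simp

lemma reflection_mult:
  "(a [^] (i::nat) \<otimes> b) \<otimes> (a [^] (j::nat) \<otimes> b) = a [^] (i + (2 * n - 1) * j)"
proof -
  have "(a [^] i \<otimes> b) \<otimes> (a [^] j \<otimes> b) = a [^] i \<otimes> (b \<otimes> a [^] j) \<otimes> b" by (simp add: m_assoc)
  also have "\<dots> = a [^] i \<otimes> a [^] ((2 * n - 1) * j) \<otimes> (b \<otimes> b)" by (simp add: b_pow m_assoc)
  finally show ?thesis by (simp add: b_order nat_pow_mult)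
qed

lemma reflection_square: "(a [^] i \<otimes> b) [^] (2::nat) = a [^] (2 * n * i)"
proof -
  have "i + (2 * n - 1) * i = 2 * n * i" using n_pos by (cases n) auto
  then show ?thesis by (simp add: numeral_2_eq_2 reflection_mult)
qed

lemma pow_add_reflection: "a [^] (i::nat) \<otimes> (a [^] (j::nat) \<otimes> b) = a [^] (i + j) \<otimes> b"
  by (simp add: m_assoc[symmetric] nat_pow_mult)

definition normal_forms :: "'a set" where
  "normal_forms = range (\<lambda>i::nat. a [^] i) \<union> range (\<lambda>i::nat. a [^] i \<otimes> b)"

lemma normal_forms_closed: "normal_forms \<subseteq> carrier G"
  by (auto simp: normal_forms_def)

text \<open>
  This is the induction step that brings an arbitrary word into normal form.
\<close>

lemma normal_forms_mult:
  assumes x: "x \<in> normal_forms"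
  shows "a \<otimes> x \<in> normal_forms" "inv a \<otimes> x \<in> normal_forms" "b \<otimes> x \<in> normal_forms" "inv b \<otimes> x \<in> normal_forms"
proof -
  have pow: "a [^] (k::nat) \<otimes> x \<in> normal_forms" for k
    using x by (auto simp: normal_forms_def nat_pow_mult pow_add_reflection)
  show "a \<otimes> x \<in> normal_forms" using pow[of 1] by simp
  have "a [^] (4 * n - 1) \<otimes> a = \<one>" using a_order n_pos by (cases "4 * n") auto
  then have "inv a = a [^] (4 * n - 1)" by (intro inv_equality) auto
  then show "inv a \<otimes> x \<in> normal_forms" using pow by simp
  have "b \<otimes> (a [^] (j::nat) \<otimes> b) = a [^] ((2 * n - 1) * j)" for j
    using reflection_mult[of 0 j] by simp
  with x show b: "b \<otimes> x \<in> normal_forms" by (auto simp: normal_forms_def b_pow)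
  have "inv b = b" using b_order by (intro inv_equality) auto
  with b show "inv b \<otimes> x \<in> normal_forms" by simp
qed

end

text \<open>
  Since the normal forms exhaust the group and are distinct for exponents that differ modulo
  \<open>4n\<close>, this characterises the semidihedral group of order \<open>8n\<close> among the groups satisfying the
  relations.
\<close>

locale semidihedral_group = semidihedral_relations +
  assumes carrier_eq: "carrier G = normal_forms"
    and pow_eqD: "\<And>(i::nat) (j::nat). a [^] i = a [^] j \<Longrightarrow> i mod (4 * n) = j mod (4 * n)"
    and pow_neq_reflection: "\<And>(i::nat) (j::nat). a [^] i \<noteq> a [^] j \<otimes> b"
    and n_ge_2: "2 \<le> n"
begin

text \<open>
  The names are those used for dihedral groups: rotations are the powers of \<open>a\<close>, and reflections
  are the elements \<open>a^i b\<close>, although those with odd \<open>i\<close> have order 4.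
\<close>

definition "rotations = range (\<lambda>i::nat. a [^] i)"
definition "centre_elem = a [^] (2 * n)"
definition "even_reflections = (\<lambda>i::nat. a [^] i \<otimes> b) ` {i. even i}"
definition "odd_reflections = (\<lambda>i::nat. a [^] i \<otimes> b) ` {i. odd i}"

lemma pow_cong: "i mod (4 * n) = j mod (4 * n) \<Longrightarrow> a [^] i = a [^] j"
  using pow_mod_of_pow_eq_one[OF a_closed a_order] by metis

lemma reflection_eqD:
  "a [^] (i::nat) \<otimes> b = a [^] (j::nat) \<otimes> b \<Longrightarrow> i mod (4 * n) = j mod (4 * n)"
  by (rule pow_eqD) simp

lemma rotations_image: "rotations = (\<lambda>i. a [^] i) ` {..<4 * n}"
  and card_rotations: "card rotations = 4 * n"
proof -
  show *: "rotations = (\<lambda>i. a [^] i) ` {..<4 * n}"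
    unfolding rotations_def
    using pow_mod_of_pow_eq_one[OF a_closed a_order] n_pos by (intro range_periodic) auto
  have "inj_on (\<lambda>i::nat. a [^] i) {..<4 * n}"
    by (rule inj_onI) (metis lessThan_iff mod_less pow_eqD)
  then show "card rotations = 4 * n" by (simp add: * card_image)
qed

text \<open>
  The parity \<open>c\<close> selects the even or the odd reflections, so that one count serves both. As the
  exponent \<open>2i + c\<close> matters modulo \<open>4n\<close>, the index \<open>i\<close> matters modulo \<open>2n\<close>.
\<close>

lemma card_reflections:
  assumes "c < 2"
  shows "card (range (\<lambda>i::nat. a [^] (2 * i + c) \<otimes> b)) = 2 * n"
    "finite (range (\<lambda>i::nat. a [^] (2 * i + c) \<otimes> b))"
proof -
  let ?f = "\<lambda>i::nat. a [^] (2 * i + c) \<otimes> b"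
  have "(2 * i + c) mod (4 * n) = (2 * (i mod (2 * n)) + c) mod (4 * n)" for i
  proof -
    have "2 * (i mod (2 * n)) = 2 * i mod (4 * n)" by (simp add: mult_mod_right)
    then show ?thesis by (simp add: mod_simps)
  qed
  then have "?f (i mod (2 * n)) = ?f i" for i using pow_cong by metis
  then have *: "range ?f = ?f ` {..<2 * n}"
    using n_pos by (intro range_periodic) auto
  have "inj_on ?f {..<2 * n}"
  proof (rule inj_onI)
    fix i j assume "i \<in> {..<2 * n}" "j \<in> {..<2 * n}" "?f i = ?f j"
    then have "(2 * i + c) mod (4 * n) = (2 * j + c) mod (4 * n)" "i < 2 * n" "j < 2 * n"
      by (blast intro: reflection_eqD, simp_all)
    moreover have "2 * i + c < 4 * n" "2 * j + c < 4 * n" using calculation assms by auto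
    ultimately show "i = j" by simp
  qed
  then show "card (range ?f) = 2 * n" by (simp add: * card_image)
  show "finite (range ?f)" by (simp add: *)
qed

lemma card_reflection_classes:
  shows "card even_reflections = 2 * n" "finite even_reflections"
    "card odd_reflections = 2 * n" "finite odd_reflections"
proof -
  have "{i::nat. even i} = range (\<lambda>i. 2 * i + 0)" "{i::nat. odd i} = range (\<lambda>i. 2 * i + 1)"
    by (auto elim: evenE oddE)
  then show "card even_reflections = 2 * n" "finite even_reflections"
    "card odd_reflections = 2 * n" "finite odd_reflections"
    using card_reflections[of 0] card_reflections[of 1]
    unfolding even_reflections_def odd_reflections_def by (simp_all only: image_image)
qed

lemma disjoint_classes:
  shows "rotations \<inter> even_reflections = {}" "rotations \<inter> odd_reflections = {}"
    "even_reflections \<inter> odd_reflections = {}"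
proof -
  show "rotations \<inter> even_reflections = {}" "rotations \<inter> odd_reflections = {}"
    using pow_neq_reflection
    by (auto simp: rotations_def even_reflections_def odd_reflections_def)
  have "even i \<longleftrightarrow> even j" if "a [^] i \<otimes> b = a [^] j \<otimes> b" for i j :: nat
  proof -
    have "i mod (4 * n) mod 2 = j mod (4 * n) mod 2" using that reflection_eqD by metis
    then have "i mod 2 = j mod 2" by (simp add: mod_mod_cancel)
    then show ?thesis by presburger
  qed
  then show "even_reflections \<inter> odd_reflections = {}"
    unfolding even_reflections_def odd_reflections_def by blast
qed

lemma carrier_partition: "carrier G = rotations \<union> even_reflections \<union> odd_reflections"
proof -
  have "(UNIV :: nat set) = {i. even i} \<union> {i. odd i}" by auto
  then have "range (\<lambda>i::nat. a [^] i \<otimes> b) = even_reflections \<union> odd_reflections"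
    unfolding even_reflections_def odd_reflections_def image_Un[symmetric] by (rule arg_cong)
  then show ?thesis by (simp add: carrier_eq normal_forms_def rotations_def Un_assoc)
qed

lemma centre_elem_facts: "centre_elem \<in> rotations" "centre_elem \<noteq> \<one>" "centre_elem \<otimes> centre_elem = \<one>"
  "\<one> \<in> rotations" "centre_elem \<in> carrier G"
proof -
  show "centre_elem \<in> rotations" by (simp add: centre_elem_def rotations_def)
  show "centre_elem \<noteq> \<one>" using pow_eqD[of "2 * n" 0] n_pos by (auto simp: centre_elem_def)
  show "centre_elem \<otimes> centre_elem = \<one>" using a_order by (simp add: centre_elem_def nat_pow_mult)
  show "\<one> \<in> rotations" unfolding rotations_def by (rule image_eqI[of _ _ 0]) auto
qed (simp add: centre_elem_def)

lemma generate_a: "generate G {a} = rotations"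
  using generate_of_pow_eq_one[OF a_closed a_order] n_pos by (simp add: rotations_image)

lemma generate_rotation:
  assumes "x \<in> rotations"
  shows "generate G {x} \<subseteq> rotations"
proof -
  obtain i :: nat where x: "x = a [^] i" "x \<in> carrier G"
    using assms by (auto simp: rotations_def)
  have "x [^] (4 * n) = (a [^] (4 * n)) [^] i" by (simp add: x nat_pow_pow mult.commute)
  then have "generate G {x} = (\<lambda>k. x [^] k) ` {..<4 * n}"
    using x n_pos by (intro generate_of_pow_eq_one) (simp_all add: a_order)
  then show ?thesis by (auto simp: x rotations_def nat_pow_pow)
qed

lemma generate_even_reflection:
  assumes "x \<in> even_reflections"
  shows "generate G {x} = {\<one>, x}"
proof -
  obtain i :: nat where x: "x = a [^] (2 * i) \<otimes> b"
    using assms by (auto simp: even_reflections_def elim: evenE)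
  have "a [^] (2 * n * (2 * i)) = a [^] (0::nat)" by (rule pow_cong) simp
  then have "x [^] (2::nat) = \<one>" unfolding x reflection_square by simp
  moreover have "x \<in> carrier G" by (simp add: x)
  ultimately have "generate G {x} = (\<lambda>k. x [^] k) ` {..<2::nat}"
    by (intro generate_of_pow_eq_one) auto
  then show ?thesis using \<open>x \<in> carrier G\<close> by (simp add: numeral_2_eq_2 lessThan_Suc insert_commute)
qed

lemma generate_odd_reflection:
  assumes "x \<in> odd_reflections"
  shows "generate G {x} = {\<one>, centre_elem, x, centre_elem \<otimes> x}"
proof -
  obtain i :: nat where x: "x = a [^] (2 * i + 1) \<otimes> b"
    using assms unfolding odd_reflections_def by (blast elim: oddE)
  have xc: "x \<in> carrier G" by (simp add: x)
  have "2 * n * (2 * i + 1) = 2 * n + 4 * n * i" by (simp add: algebra_simps)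
  then have "a [^] (2 * n * (2 * i + 1)) = centre_elem"
    unfolding centre_elem_def by (intro pow_cong) (simp only: mod_mult_self2)
  then have sq: "x [^] (2::nat) = centre_elem" unfolding x reflection_square by simp
  have cube: "x [^] (3::nat) = centre_elem \<otimes> x"
    using sq xc by (simp add: numeral_3_eq_3 numeral_2_eq_2)
  have "x [^] (4::nat) = x [^] (2::nat) \<otimes> x [^] (2::nat)" using xc by (simp add: nat_pow_mult)
  then have "x [^] (4::nat) = \<one>" using sq centre_elem_facts by simp
  then have "generate G {x} = (\<lambda>k. x [^] k) ` {..<4::nat}"
    using xc by (intro generate_of_pow_eq_one) auto
  also have "{..<4::nat} = {0, 1, 2, 3}" by auto
  finally show ?thesis using sq cube xc by auto
qed

lemma mate_odd_reflection:
  assumes "x \<in> odd_reflections"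
  shows "centre_elem \<otimes> x \<in> odd_reflections" "centre_elem \<otimes> x \<noteq> x"
    "centre_elem \<otimes> (centre_elem \<otimes> x) = x"
proof -
  have xc: "x \<in> carrier G" using assms carrier_partition by auto
  obtain i :: nat where x: "x = a [^] i \<otimes> b" "odd i" using assms by (auto simp: odd_reflections_def)
  then have "centre_elem \<otimes> x = a [^] (2 * n + i) \<otimes> b" "odd (2 * n + i)"
    by (simp_all add: centre_elem_def pow_add_reflection)
  then show "centre_elem \<otimes> x \<in> odd_reflections" unfolding odd_reflections_def by blast
  show "centre_elem \<otimes> x \<noteq> x" using centre_elem_facts xc by (simp add: r_cancel_one)
  show "centre_elem \<otimes> (centre_elem \<otimes> x) = x"
    using centre_elem_facts xc by (simp add: m_assoc[symmetric])
qed

lemma card_proper_rotations: "card (rotations - {\<one>, centre_elem}) = 4 * n - 2"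
  using centre_elem_facts by (subst card_Diff_subset) (auto simp: card_rotations)

text \<open>
  Every cyclic subgroup lies in a block, and every block is a cyclic subgroup. So two vertices
  are adjacent if and only if they lie in a common block.
\<close>

sublocale hub_graph "enhanced_power_graph G" "\<one>" centre_elem "rotations - {\<one>, centre_elem}"
  even_reflections odd_reflections "\<lambda>x. centre_elem \<otimes> x"
proof
  let ?A = "rotations - {\<one>, centre_elem}"
  have K: "{\<one>, centre_elem} \<union> ?A = rotations" using centre_elem_facts by auto
  show "pverts (enhanced_power_graph G) = {\<one>, centre_elem} \<union> ?A \<union> even_reflections \<union> odd_reflections"
    unfolding K by (simp add: enhanced_power_graph_def carrier_partition)
  have fin: "finite rotations" by (simp add: rotations_image)
  show "2 \<le> card ?A" using n_ge_2 card_proper_rotations by simp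
  show "finite ?A" using fin by simp
  show "even_reflections \<noteq> {}" "4 \<le> card odd_reflections" using card_reflection_classes n_ge_2 by auto
  let ?B = "hub_blocks \<one> centre_elem ?A even_reflections odd_reflections (\<lambda>x. centre_elem \<otimes> x)"
  have sub: "\<exists>B\<in>?B. generate G {w} \<subseteq> B" if "w \<in> carrier G" for w
    using that generate_rotation[of w] generate_even_reflection[of w] generate_odd_reflection[of w]
    unfolding carrier_partition hub_blocks_def K by blast
  have sup: "\<exists>w\<in>carrier G. B = generate G {w}" if B: "B \<in> ?B" for B
  proof -
    consider "B = rotations" | x where "x \<in> even_reflections" "B = {\<one>, x}"
      | x where "x \<in> odd_reflections" "B = {\<one>, centre_elem, x, centre_elem \<otimes> x}"
      using B unfolding hub_blocks_def K by blast
    then show ?thesis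
    proof cases
      case 1
      then show ?thesis using generate_a a_closed by blast
    next
      case (2 x)
      then show ?thesis using generate_even_reflection[of x] carrier_partition
        by (intro bexI[of _ x]) simp_all
    next
      case (3 x)
      then show ?thesis using generate_odd_reflection[of x] carrier_partition
        by (intro bexI[of _ x]) simp_all
    qed
  qed
  show "(x, y) \<in> parcs (enhanced_power_graph G) \<longleftrightarrow> x \<noteq> y \<and> (\<exists>B\<in>?B. x \<in> B \<and> y \<in> B)" for x y
  proof -
    have "generate G {w} \<subseteq> carrier G" if "w \<in> carrier G" for w
      using that by (intro generate_incl) simp
    then have "(x, y) \<in> parcs (enhanced_power_graph G) \<longleftrightarrow>
        x \<noteq> y \<and> (\<exists>w\<in>carrier G. x \<in> generate G {w} \<and> y \<in> generate G {w})"
      unfolding enhanced_power_graph_def by auto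
    also have "(\<exists>w\<in>carrier G. x \<in> generate G {w} \<and> y \<in> generate G {w}) \<longleftrightarrow>
        (\<exists>B\<in>?B. x \<in> B \<and> y \<in> B)"
    proof
      assume "\<exists>w\<in>carrier G. x \<in> generate G {w} \<and> y \<in> generate G {w}"
      then obtain w where w: "w \<in> carrier G" "x \<in> generate G {w}" "y \<in> generate G {w}" by blast
      obtain B where "B \<in> ?B" "generate G {w} \<subseteq> B" using sub[OF w(1)] by blast
      with w show "\<exists>B\<in>?B. x \<in> B \<and> y \<in> B" by (intro bexI[of _ B]) auto
    next
      assume "\<exists>B\<in>?B. x \<in> B \<and> y \<in> B"
      then obtain B where B: "B \<in> ?B" "x \<in> B" "y \<in> B" by (elim bexE conjE)
      obtain w where "w \<in> carrier G" "B = generate G {w}" using sup[OF B(1)] by blast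
      with B show "\<exists>w\<in>carrier G. x \<in> generate G {w} \<and> y \<in> generate G {w}"
        by (intro bexI[of _ w]) simp_all
    qed
    finally show ?thesis .
  qed
qed (use card_reflection_classes centre_elem_facts disjoint_classes mate_odd_reflection in auto)

end

section \<open>The presented group\<close>

text \<open>
  To see that the normal forms are distinct, words act on normal forms by left multiplication:
  the pair \<open>(i, s)\<close> stands for \<open>a^i\<close> or \<open>a^i b\<close>. Exponents are arbitrary integers that are compared
  modulo \<open>4n\<close> by \<open>sd_sim\<close>; without reduction modulo \<open>4n\<close>, letters act by affine maps and
  cancellation of \<open>a\<close> with its inverse holds exactly.
\<close>

fun sd_step :: "nat \<Rightarrow> sd_gen \<times> bool \<Rightarrow> int \<times> bool \<Rightarrow> int \<times> bool" where
  "sd_step n (Gen_a, True) (i, s) = (i + 1, s)"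
| "sd_step n (Gen_a, False) (i, s) = (i - 1, s)"
| "sd_step n (Gen_b, _) (i, s) = ((2 * int n - 1) * i, \<not> s)"

definition sd_sim :: "nat \<Rightarrow> int \<times> bool \<Rightarrow> int \<times> bool \<Rightarrow> bool" where
  "sd_sim n x y \<longleftrightarrow> 4 * int n dvd fst x - fst y \<and> snd x = snd y"

lemma sd_sim_refl: "sd_sim n x x"
  and sd_sim_sym: "sd_sim n x y \<Longrightarrow> sd_sim n y x"
  and sd_sim_trans: "sd_sim n x y \<Longrightarrow> sd_sim n y w \<Longrightarrow> sd_sim n x w"
proof -
  show "sd_sim n x y \<Longrightarrow> sd_sim n y x" by (auto simp: sd_sim_def dvd_diff_commute)
  assume "sd_sim n x y" "sd_sim n y w"
  then show "sd_sim n x w"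
    using dvd_add[of "4 * int n" "fst x - fst y" "fst y - fst w"] by (simp add: sd_sim_def)
qed (simp add: sd_sim_def)

lemma sd_sim_step: "sd_sim n x y \<Longrightarrow> sd_sim n (sd_step n c x) (sd_step n c y)"
  by (cases "(n, c, x)" rule: sd_step.cases; cases y)
    (auto simp: sd_sim_def right_diff_distrib[symmetric])

lemma sd_sim_foldr: "sd_sim n x y \<Longrightarrow> sd_sim n (foldr (sd_step n) u x) (foldr (sd_step n) u y)"
  by (induction u) (auto intro: sd_sim_step)

lemma sd_step_a_funpow: "(sd_step n (Gen_a, True) ^^ k) (i, s) = (i + int k, s)"
  by (induction k) auto

text \<open>
  The multiplier \<open>2n - 1\<close> is an involution modulo \<open>4n\<close>: \<open>(2n - 1)^2 - 1 = 4n (n - 1)\<close>.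
\<close>

lemma sd_step_b_b: "sd_sim n (sd_step n (Gen_b, s) (sd_step n (Gen_b, t) x)) x"
proof -
  have "(2 * int n - 1) * ((2 * int n - 1) * i) - i = 4 * int n * ((int n - 1) * i)" for i
    by (simp add: algebra_simps)
  then show ?thesis by (cases x) (simp add: sd_sim_def)
qed

lemma sd_step_cancel: "sd_sim n (sd_step n (g, s) (sd_step n (g, \<not> s) x)) x"
proof (cases g)
  case Gen_a
  then show ?thesis by (cases x; cases s) (simp_all add: sd_sim_def)
qed (simp add: sd_step_b_b)

lemma sd_step_relation:
  assumes "(l, r) \<in> sd_relations n" "0 < n"
  shows "sd_sim n (foldr (sd_step n) l x) (foldr (sd_step n) r x)"
proof -
  obtain i s where x: "x = (i, s)" by (cases x)
  have "int (2 * n - 1) = 2 * int n - 1" using assms(2) by auto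
  then show ?thesis using assms(1) sd_step_b_b
    by (auto simp: sd_relations_def Let_def x sd_step_a_funpow sd_sim_def algebra_simps)
qed

lemma word_cong_sd_sim:
  assumes "word_cong (sd_relations n) u v" "0 < n"
  shows "sd_sim n (foldr (sd_step n) u x) (foldr (sd_step n) v x)"
  using assms(1)
proof (induction arbitrary: x rule: word_cong.induct)
  case (cancel u g s v)
  show ?case using sd_sim_foldr[OF sd_step_cancel[of n g s "foldr (sd_step n) v x"], of u] by simp
next
  case (rel l r u v)
  show ?case
    using sd_sim_foldr[OF sd_step_relation[OF rel assms(2), of "foldr (sd_step n) v x"], of u] by simp
qed (blast intro: sd_sim_refl sd_sim_sym sd_sim_trans)+

definition sd_gen_class :: "nat \<Rightarrow> sd_gen \<Rightarrow> sd_gen gword set" where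
  "sd_gen_class n g = word_class (sd_relations n) [(g, True)]"

lemma presented_group_one: "\<one>\<^bsub>presented_group R\<^esub> = word_class R []"
  by (simp add: presented_group_def)

lemma word_class_closed: "word_class R u \<in> carrier (presented_group R)"
  by (simp add: presented_group_def)

lemma presented_group_pow:
  "word_class R u [^]\<^bsub>presented_group R\<^esub> (k::nat) = word_class R (concat (replicate k u))"
proof (induction k)
  case (Suc k)
  have "concat (replicate k u) @ u = u @ concat (replicate k u)" by (induction k) auto
  then show ?case by (simp add: Suc presented_group_mult)
qed (simp add: presented_group_one)

lemma word_class_inv_letter:
  "inv\<^bsub>presented_group R\<^esub> (word_class R [(x, True)]) = word_class R [(x, False)]"
proof -
  interpret group "presented_group R" by (rule group_presented_group)
  have "word_cong R [(x, False), (x, True)] []"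
    using word_cong.cancel[of R "[]" x False "[]"] by simp
  then show ?thesis
    by (intro inv_equality) (simp_all add: word_class_closed presented_group_mult presented_group_one word_class_eq_iff)
qed

text \<open>
  The word action separates the normal forms because it maps \<open>(0, False)\<close>, the pair for the
  neutral element, to the pair of the normal form itself.
\<close>

lemma semidihedral_group_semidihedral:
  assumes "2 \<le> n"
  shows "semidihedral_group (semidihedral n) n (sd_gen_class n Gen_a) (sd_gen_class n Gen_b)"
proof -
  let ?R = "sd_relations n" and ?a = "sd_gen_class n Gen_a" and ?b = "sd_gen_class n Gen_b"
  let ?G = "presented_group ?R"
  interpret group ?G by (rule group_presented_group)
  have "word_cong ?R l r" if "(l, r) \<in> ?R" for l r
    using word_cong.rel[OF that, of "[]" "[]"] by simp
  then have rels: "word_class ?R l = word_class ?R r" if "(l, r) \<in> ?R" for l r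
    using that by (simp add: word_class_eq_iff)
  have pow: "?a [^]\<^bsub>?G\<^esub> i = word_class ?R (replicate i (Gen_a, True))" for i :: nat
    unfolding sd_gen_class_def presented_group_pow by (induction i) auto
  have refl: "?a [^]\<^bsub>?G\<^esub> i \<otimes>\<^bsub>?G\<^esub> ?b = word_class ?R (replicate i (Gen_a, True) @ [(Gen_b, True)])"
    for i :: nat
    unfolding pow by (simp add: sd_gen_class_def presented_group_mult)
  interpret semidihedral_relations ?G n ?a ?b
  proof
    show "0 < n" using assms by simp
    show "?a \<in> carrier ?G" "?b \<in> carrier ?G" by (simp_all add: sd_gen_class_def word_class_closed)
    show "?a [^]\<^bsub>?G\<^esub> (4 * n) = \<one>\<^bsub>?G\<^esub>"
      unfolding pow presented_group_one by (rule rels) (simp add: sd_relations_def Let_def)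
    show "?b \<otimes>\<^bsub>?G\<^esub> ?b = \<one>\<^bsub>?G\<^esub>"
      unfolding sd_gen_class_def presented_group_mult presented_group_one
      by (rule rels) (simp add: sd_relations_def Let_def)
    show "?b \<otimes>\<^bsub>?G\<^esub> ?a = ?a [^]\<^bsub>?G\<^esub> (2 * n - 1) \<otimes>\<^bsub>?G\<^esub> ?b"
      unfolding refl unfolding sd_gen_class_def presented_group_mult
      by (rule rels) (simp add: sd_relations_def Let_def)
  qed
  have "word_class ?R w \<in> normal_forms" for w
  proof (induction w)
    case Nil
    have "?a [^]\<^bsub>?G\<^esub> (0::nat) \<in> normal_forms" unfolding normal_forms_def by blast
    then show ?case by (simp add: presented_group_one)
  next
    case (Cons c w)
    obtain g s where c: "c = (g, s)" by (cases c)
    have "word_class ?R (c # w) = word_class ?R [c] \<otimes>\<^bsub>?G\<^esub> word_class ?R w"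
      by (simp add: presented_group_mult)
    moreover have "word_class ?R [c] =
        (if s then sd_gen_class n g else inv\<^bsub>?G\<^esub> (sd_gen_class n g))"
      by (simp add: c sd_gen_class_def word_class_inv_letter)
    ultimately show ?case using normal_forms_mult[OF Cons.IH] by (cases g) auto
  qed
  then have carrier: "carrier ?G = normal_forms"
    using normal_forms_closed by (auto simp: presented_group_def)
  have "semidihedral_group ?G n ?a ?b"
  proof
    show "carrier ?G = normal_forms" by (rule carrier)
    show "2 \<le> n" by (rule assms)
    fix i j :: nat
    show "i mod (4 * n) = j mod (4 * n)" if "?a [^]\<^bsub>?G\<^esub> i = ?a [^]\<^bsub>?G\<^esub> j"
    proof -
      have "4 * int n dvd int i - int j"
        using word_cong_sd_sim[of n "replicate i (Gen_a, True)" "replicate j (Gen_a, True)" "(0, False)"]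
          that assms
        by (simp add: pow word_class_eq_iff sd_step_a_funpow sd_sim_def)
      then have "int i mod int (4 * n) = int j mod int (4 * n)" by (simp add: mod_eq_dvd_iff)
      then show ?thesis by (simp only: zmod_int[symmetric] of_nat_eq_iff)
    qed
    show "?a [^]\<^bsub>?G\<^esub> i \<noteq> ?a [^]\<^bsub>?G\<^esub> j \<otimes>\<^bsub>?G\<^esub> ?b"
    proof
      assume "?a [^]\<^bsub>?G\<^esub> i = ?a [^]\<^bsub>?G\<^esub> j \<otimes>\<^bsub>?G\<^esub> ?b"
      then have "word_cong ?R (replicate i (Gen_a, True)) (replicate j (Gen_a, True) @ [(Gen_b, True)])"
        unfolding refl unfolding pow word_class_eq_iff .
      from word_cong_sd_sim[OF this, of "(0, False)"] show False
        using assms by (simp add: sd_step_a_funpow sd_sim_def)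
    qed
  qed
  then show ?thesis by (simp add: semidihedral_def)
qed

section \<open>The enhanced power graph of the semidihedral group\<close>

theorem theorem3p7:
  fixes n :: nat
  assumes "n \<ge> 2"
  shows "graph_dds (enhanced_power_graph (semidihedral n)) =
      {# [1, 2 * n] @ replicate (4 * n - 3) 0 @ [1, 0, 6 * n - 2] #}
    + {# [1] @ replicate (4 * n - 2) 0 @ [1, 2 * n, 6 * n - 2] #}
    + replicate_mset (4 * n - 2)
        ([1] @ replicate (4 * n) 0 @ [4 * n - 1] @ replicate 2 (2 * n))
    + replicate_mset (2 * n)
        (replicate 2 1 @ [2 * n - 1] @ replicate (4 * n - 3) 0 @ [1, 0, 6 * n - 2])
    + replicate_mset (2 * n)
        ([1] @ replicate (4 * n) 0 @ [3, 2 * n, 6 * n - 4])"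
proof -
  interpret semidihedral_group "semidihedral n" n "sd_gen_class n Gen_a" "sd_gen_class n Gen_b"
    using assms by (rule semidihedral_group_semidihedral)
  have "4 * n - 2 - 1 = 4 * n - 3" "4 * n - 2 + 2 * n = 6 * n - 2" "4 * n - 2 + 2 = 4 * n"
    "4 * n - 2 + 1 = 4 * n - 1" "6 * n - 2 - 2 = 6 * n - 4"
    using assms by auto
  then show ?thesis
    using graph_dds_hub_graph unfolding card_proper_rotations card_reflection_classes
    by (simp add: numeral_2_eq_2)
qed

end
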